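(* Let $N\ge 1$, $s\in(0,1)$, let $u_0\in C_0^\infty(\mathbb{R}^N)$ with $\operatorname{supp}(u_0)\subset B_L(0)$ for some $L>0$, and let $u=u(x,t)$ be the solution of the Cauchy problem for the fractional heat equation $$\partial_t u+(-\Delta)^s u=0 \ \text{ in } \mathbb{R}^N\times(0,\infty),\qquad u(x,0)=u_0(x)\ \text{ for } x\in\mathbb{R}^N.$$ Then the following conditions are equivalent: (1) $u(0,t)=0$ for any $t>0$; (2) $\displaystyle\int_{\mathbb{S}^{N-1}}u_0(r\omega)\,d\omega=0$ for any $r\ge 0$.
   Context: $B_L(0)$ is the open ball of radius $L$ centered at the origin of $\mathbb{R}^N$; $\mathbb{S}^{N-1}$ is the unit sphere centered at the origin with surface measure $d\omega$ (counting measure on $\{\pm1\}$ if $N=1$). The fractional Laplacian is $(-\Delta)^s u(x)=c_{N,s}\lim_{\varepsilon\to0^+}\int_{|y-x|>\varepsilon}\frac{u(x)-u(y)}{|x-y|^{N+2s}}\,dy$ with $c_{N,s}=\frac{2^{2s}s\,\Gamma((N+2s)/2)}{\pi^{N/2}\Gamma(1-s)}$; equivalently, with the Fourier transform $\mathcal{F}f(\xi)=\int_{\mathbb{R}^N}f(x)e^{-2\pi i x\cdot\xi}dx$, it is the Fourier multiplier with symbol $(2\pi|\xi|)^{2s}$. The solution of the Cauchy problem is $u(x,t)=\int_{\mathbb{R}^N}P(x-y,t;s)u_0(y)\,dy$, where $P(\cdot,t;s)=\mathcal{F}^{-1}\big(e^{-t(2\pi|\xi|)^{2s}}\big)$ is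 the fractional heat kernel. *)

theory Defs
  imports "HOL-Analysis.Analysis"
begin

fun Ck :: "nat \<Rightarrow> ('a::euclidean_space \<Rightarrow> 'b::real_normed_vector) \<Rightarrow> bool" where
  "Ck 0 f \<longleftrightarrow> continuous_on UNIV f"
| "Ck (Suc k) f \<longleftrightarrow>
     (\<forall>x. f differentiable (at x)) \<and> (\<forall>v. Ck k (\<lambda>x. frechet_derivative f (at x) v))"

definition supp :: "('a::topological_space \<Rightarrow> 'b::zero) \<Rightarrow> 'a set" where
  "supp f = closure {x. f x \<noteq> 0}"

definition test_function :: "('a::euclidean_space \<Rightarrow> 'b::real_normed_vector) \<Rightarrow> bool" where
  "test_function f \<longleftrightarrow> (\<forall>k. Ck k f) \<and> compact (supp f)"

definition inv_fourier :: "('a::euclidean_space \<Rightarrow> complex) \<Rightarrow> 'a \<Rightarrow> complex" where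
  "inv_fourier f x = (\<integral>\<xi>. f \<xi> * exp (2 * pi * \<i> * complex_of_real (x \<bullet> \<xi>)) \<partial>lborel)"

definition frac_heat_kernel :: "real \<Rightarrow> 'a::euclidean_space \<Rightarrow> real \<Rightarrow> complex" where
  "frac_heat_kernel s x t =
     inv_fourier (\<lambda>\<xi>. complex_of_real (exp (- t * (2 * pi * norm \<xi>) powr (2 * s)))) x"

text \<open>
  The kernel exists only for positive times; at time \<open>0\<close> the solution is the initial datum.
  Since the kernel is an inverse Fourier transform, the solution is taken with complex values.
\<close>

definition frac_heat_solution :: "real \<Rightarrow> ('a::euclidean_space \<Rightarrow> real) \<Rightarrow> 'a \<Rightarrow> real \<Rightarrow> complex" where
  "frac_heat_solution s u0 x t =
     (if t = 0 then complex_of_real (u0 x)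
      else (\<integral>y. frac_heat_kernel s (x - y) t * complex_of_real (u0 y) \<partial>lborel))"

text \<open>
  Surface measure on the unit sphere of an \<open>N\<close>-dimensional space: a Borel set \<open>A\<close> has measure
  \<open>N\<close> times the volume of the cone over \<open>A\<close> inside the punctured unit ball
  (see \<open>emeasure_sphere_measure\<close>). For \<open>N = 1\<close> this is counting measure on the two unit vectors
  (see \<open>sphere_measure_real\<close>).
\<close>

definition sphere_measure :: "'a::euclidean_space measure" where
  "sphere_measure =
     scale_measure (of_nat DIM('a))
       (distr (restrict_space lborel (ball 0 1 - {0})) (restrict_space borel (sphere 0 1))
         (\<lambda>x. x /\<^sub>R norm x))"

lemma radial_projection_measurable:
  "(\<lambda>x::'a::euclidean_space. x /\<^sub>R norm x)
     \<in> restrict_space lborel (ball 0 1 - {0}) \<rightarrow>\<^sub>M restrict_space borel (sphere 0 1)"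
  by (rule measurable_restrict_space2) (auto intro!: measurable_restrict_space1)

lemma emeasure_sphere_measure:
  assumes "A \<in> sets borel" "A \<subseteq> sphere (0::'a::euclidean_space) 1"
  shows "emeasure sphere_measure A =
           of_nat DIM('a) * emeasure lborel {x \<in> ball 0 1 - {0}. x /\<^sub>R norm x \<in> A}"
proof -
  have A: "A \<in> sets (restrict_space borel (sphere 0 1))"
    using assms by (auto simp: sets_restrict_space image_iff)
  have eq: "(\<lambda>x. x /\<^sub>R norm x) -` A \<inter> (ball 0 1 - {0}) =
      {x \<in> ball 0 1 - {0}. x /\<^sub>R norm x \<in> A}"
    by auto
  have "emeasure (restrict_space lborel (ball 0 1 - {0})) {x \<in> ball 0 1 - {0}. x /\<^sub>R norm x \<in> A} =
      emeasure lborel {x \<in> ball 0 1 - {0}. x /\<^sub>R norm x \<in> A}"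
    by (rule emeasure_restrict_space) auto
  then show ?thesis
    unfolding sphere_measure_def
    by (simp only: emeasure_scale_measure emeasure_distr[OF radial_projection_measurable A]
        space_restrict_space space_lborel space_borel Int_UNIV_right eq)
qed

lemma sphere_measure_real:
  "emeasure (sphere_measure :: real measure) {1} = 1"
  "emeasure (sphere_measure :: real measure) {-1} = 1"
proof -
  have 1: "{x \<in> ball (0::real) 1 - {0}. x /\<^sub>R norm x \<in> {1}} = {0<..<1}"
    by (auto simp: field_simps abs_if split: if_splits)
  have 2: "{x \<in> ball (0::real) 1 - {0}. x /\<^sub>R norm x \<in> {-1}} = {-1<..<0}"
    by (auto simp: field_simps abs_if split: if_splits)
  show "emeasure (sphere_measure :: real measure) {1} = 1"
    by (subst emeasure_sphere_measure) (simp_all only: 1, auto)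
  show "emeasure (sphere_measure :: real measure) {-1} = 1"
    by (subst emeasure_sphere_measure) (simp_all only: 2, auto)
qed

end

theory Submission
  imports Defs "HOL-Probability.Probability" "HOL-Real_Asymp.Real_Asymp"
begin

text \<open>
  By Fubini, \<open>u 0 t\<close> is the integral of \<open>exp (- t * (2 * pi * |\<xi>|) powr (2 * s))\<close> against the Fourier transform of
  \<open>u0\<close>. Stone-Weierstrass in the variable \<open>exp (- |\<xi>| powr a)\<close> shows that the vanishing of such
  integrals for all \<open>t > 0\<close> does not depend on the exponent \<open>a\<close>, so \<open>2 * s\<close> can be replaced
  by \<open>2\<close>. The Fourier transform of a Gaussian is a Gaussian, hence the condition becomes that
  \<open>u0\<close> itself is orthogonal to all centred Gaussians. By the same density argument \<open>u0\<close> is then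
  orthogonal to all radial functions, in particular to its own spherical mean, and in polar
  coordinates this says that the spherical mean vanishes.
\<close>

subsection \<open>Laplace uniqueness\<close>

text \<open>In the variable \<open>w = exp (- \<rho> x)\<close>, which lies in [0,1], the hypothesis
  says that \<open>exp (- \<rho> x) *\<^sub>R f x\<close> is orthogonal to all powers of
  \<open>w\<close>. By Stone-Weierstrass polynomials approximate \<open>g\<close> uniformly on
  [0,1], and integrability turns this into convergence of the integrals.\<close>

lemma integral_exp_scaled_eq_0:
  fixes f :: "'x \<Rightarrow> 'b::{banach, second_countable_topology}" and g :: "real \<Rightarrow> real"
  assumes [measurable]: "\<rho> \<in> borel_measurable M"
    and pos: "\<And>x. 0 \<le> \<rho> x"
    and int: "integrable M (\<lambda>x. exp (- \<rho> x) *\<^sub>R f x)"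
    and zero: "\<And>n::nat. n > 0 \<Longrightarrow> (\<integral>x. exp (- (real n * \<rho> x)) *\<^sub>R f x \<partial>M) = 0"
    and g: "continuous_on {0..1} g"
    and gm: "(\<lambda>x. g (exp (- \<rho> x))) \<in> borel_measurable M"
  shows "(\<integral>x. g (exp (- \<rho> x)) *\<^sub>R exp (- \<rho> x) *\<^sub>R f x \<partial>M) = 0"
proof -
  define h where "h x = exp (- \<rho> x) *\<^sub>R f x" for x
  have h: "integrable M h" unfolding h_def by (fact int)
  have unit: "exp (- \<rho> x) \<in> {0..1}" for x using pos[of x] by auto
  have mult: "integrable M (\<lambda>x. q x *\<^sub>R h x)"
    if [measurable]: "q \<in> borel_measurable M" and "\<And>x. \<bar>q x\<bar> \<le> C" for q :: "'x \<Rightarrow> real" and C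
  proof (rule Bochner_Integration.integrable_bound[of M "\<lambda>x. C *\<^sub>R h x"])
    show "integrable M (\<lambda>x. C *\<^sub>R h x)" using h by simp
    show "(\<lambda>x. q x *\<^sub>R h x) \<in> borel_measurable M" using h by measurable
    show "AE x in M. norm (q x *\<^sub>R h x) \<le> norm (C *\<^sub>R h x)"
    proof (rule AE_I2)
      fix x
      have "\<bar>q x\<bar> \<le> \<bar>C\<bar>" using that(2)[of x] by linarith
      then show "norm (q x *\<^sub>R h x) \<le> norm (C *\<^sub>R h x)" by (simp add: mult_right_mono)
    qed
  qed
  have pow: "integrable M (\<lambda>x. (exp (- \<rho> x)) ^ i *\<^sub>R h x)" for i
    by (rule mult[of _ 1]) (use pos in \<open>auto simp: power_le_one\<close>)
  have poly: "(\<integral>x. p (exp (- \<rho> x)) *\<^sub>R h x \<partial>M) = 0 \<and> integrable M (\<lambda>x. p (exp (- \<rho> x)) *\<^sub>R h x)"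
    if p: "real_polynomial_function p" for p
  proof -
    obtain a n where p: "p = (\<lambda>x. \<Sum>i\<le>n. a i * x ^ i)"
      using p by (auto simp: real_polynomial_function_iff_sum)
    have "(\<integral>x. (exp (- \<rho> x)) ^ i *\<^sub>R h x \<partial>M) = 0" for i
    proof -
      \<comment> \<open>The factor \<open>exp (- \<rho> x)\<close> inside \<open>h\<close> raises
        the power by one, so that the hypothesis for \<open>n > 0\<close> also covers the constant
        term \<open>i = 0\<close>.\<close>
      have "(exp (- \<rho> x)) ^ i *\<^sub>R h x = exp (- (real (Suc i) * \<rho> x)) *\<^sub>R f x" for x
        by (simp add: h_def exp_of_nat_mult[symmetric] exp_add[symmetric] algebra_simps)
      then show ?thesis using zero[of "Suc i"] by simp
    qed
    moreover have eq: "p (exp (- \<rho> x)) *\<^sub>R h x = (\<Sum>i\<le>n. a i *\<^sub>R (exp (- \<rho> x)) ^ i *\<^sub>R h x)" for x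
      by (simp add: p scaleR_sum_left)
    moreover have "integrable M (\<lambda>x. a i *\<^sub>R (exp (- \<rho> x)) ^ i *\<^sub>R h x)" for i
      using pow by (rule integrable_scaleR_right)
    ultimately show ?thesis
      unfolding eq by (subst Bochner_Integration.integral_sum) (auto simp del: scaleR_scaleR)
  qed
  have small: "norm (\<integral>x. g (exp (- \<rho> x)) *\<^sub>R h x \<partial>M) \<le> e * (\<integral>x. norm (h x) \<partial>M)" if "e > 0" for e
  proof -
    obtain p where p: "real_polynomial_function p" "\<And>x. x \<in> {0..1} \<Longrightarrow> \<bar>g x - p x\<bar> < e"
      using Stone_Weierstrass_real_polynomial_function[OF compact_Icc g \<open>e > 0\<close>] by auto
    have pm [measurable]: "(\<lambda>x. p (exp (- \<rho> x))) \<in> borel_measurable M"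
    proof -
      have "continuous_on UNIV p"
        using p(1) continuous_on_polymonial_function real_polynomial_function_eq by blast
      then have [measurable]: "p \<in> borel_measurable borel" by (rule borel_measurable_continuous_onI)
      show ?thesis by measurable
    qed
    note gm[measurable]
    have b: "\<bar>g (exp (- \<rho> x)) - p (exp (- \<rho> x))\<bar> \<le> e" for x
      using p(2)[OF unit[of x]] by simp
    have d: "integrable M (\<lambda>x. (g (exp (- \<rho> x)) - p (exp (- \<rho> x))) *\<^sub>R h x)"
      by (rule mult[OF _ b]) measurable
    have "(\<integral>x. g (exp (- \<rho> x)) *\<^sub>R h x \<partial>M)
        = (\<integral>x. (g (exp (- \<rho> x)) - p (exp (- \<rho> x))) *\<^sub>R h x + p (exp (- \<rho> x)) *\<^sub>R h x \<partial>M)"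
      by (simp add: scaleR_diff_left)
    also have "\<dots> = (\<integral>x. (g (exp (- \<rho> x)) - p (exp (- \<rho> x))) *\<^sub>R h x \<partial>M)"
      using d poly[OF p(1)] by (subst Bochner_Integration.integral_add) auto
    also have "norm \<dots> \<le> (\<integral>x. e * norm (h x) \<partial>M)"
    proof (rule order_trans[OF integral_norm_bound integral_mono])
      show "integrable M (\<lambda>x. norm ((g (exp (- \<rho> x)) - p (exp (- \<rho> x))) *\<^sub>R h x))" using d by (rule integrable_norm)
      show "integrable M (\<lambda>x. e * norm (h x))" using h by simp
      show "norm ((g (exp (- \<rho> x)) - p (exp (- \<rho> x))) *\<^sub>R h x) \<le> e * norm (h x)" for x
        unfolding norm_scaleR by (rule mult_right_mono[OF b]) simp
    qed
    finally show ?thesis by simp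
  qed
  have "norm (\<integral>x. g (exp (- \<rho> x)) *\<^sub>R h x \<partial>M) \<le> 0"
  proof (rule tendsto_lowerbound)
    show "((\<lambda>e. e * (\<integral>x. norm (h x) \<partial>M)) \<longlongrightarrow> 0) (at_right (0::real))"
      by (auto intro!: tendsto_eq_intros)
    show "\<forall>\<^sub>F e in at_right 0. norm (\<integral>x. g (exp (- \<rho> x)) *\<^sub>R h x \<partial>M) \<le> e * (\<integral>x. norm (h x) \<partial>M)"
      using eventually_at_right_less[of 0] by eventually_elim (rule small)
  qed simp
  then show ?thesis by (simp add: h_def)
qed

text \<open>Formally \<open>k v = g (exp (- v)) * exp (- v)\<close> with
  \<open>g w = k (- ln w) / w\<close>, but this \<open>g\<close> may be singular at
  \<open>w = 0\<close>. Hence \<open>k\<close> is first cut off at large \<open>v\<close>, and the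
  cutoff is then removed by dominated convergence with majorant
  \<open>norm (k (\<rho> x) *\<^sub>R f x)\<close>. In this form \<open>k\<close> may be
  unbounded.\<close>

lemma laplace_uniqueness:
  fixes f :: "'x \<Rightarrow> 'b::{banach, second_countable_topology}" and k :: "real \<Rightarrow> real"
  assumes [measurable]: "\<rho> \<in> borel_measurable M"
    and pos: "\<And>x. 0 \<le> \<rho> x"
    and int: "integrable M (\<lambda>x. exp (- \<rho> x) *\<^sub>R f x)"
    and zero: "\<And>n::nat. n > 0 \<Longrightarrow> (\<integral>x. exp (- (real n * \<rho> x)) *\<^sub>R f x \<partial>M) = 0"
    and k: "continuous_on UNIV k"
    and kint: "integrable M (\<lambda>x. k (\<rho> x) *\<^sub>R f x)"
  shows "(\<integral>x. k (\<rho> x) *\<^sub>R f x \<partial>M) = 0"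
proof -
  \<comment> \<open>A continuous cutoff: 1 for \<open>v \<le> n - 1\<close>, 0 for
    \<open>v \<ge> n\<close>, linear in between.\<close>
  define c where "c n v = max 0 (min 1 (real n - v))" for n v
  have km [measurable]: "k \<in> borel_measurable borel"
    using k by (rule borel_measurable_continuous_onI)
  have cm [measurable]: "c n \<in> borel_measurable borel" for n
    unfolding c_def by measurable
  have cutoff: "(\<integral>x. c n (\<rho> x) *\<^sub>R k (\<rho> x) *\<^sub>R f x \<partial>M) = 0" for n
  proof -
    \<comment> \<open>The cutoff lets \<open>k (- ln w) / w\<close> be extended continuously to \<open>w = 0\<close>.\<close>
    define z where "z w = max w (exp (- real n))" for w
    define g where "g w = c n (- ln (z w)) * k (- ln (z w)) / z w" for w
    have zpos: "z w > 0" for w unfolding z_def by (simp add: less_max_iff_disj)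
    have z: "continuous_on UNIV z" unfolding z_def by (intro continuous_intros)
    have z_nz: "z w \<noteq> 0" for w using zpos[of w] by simp
    have ln_z: "continuous_on UNIV (\<lambda>w. - ln (z w))"
      using z z_nz by (intro continuous_on_minus continuous_on_ln) auto
    have c: "continuous_on UNIV (c n)" unfolding c_def by (intro continuous_intros)
    have cont: "continuous_on UNIV g"
      unfolding g_def
    proof (intro continuous_on_divide continuous_on_mult z ballI z_nz)
      show "continuous_on UNIV (\<lambda>w. c n (- ln (z w)))"
        by (rule continuous_on_compose2[OF c ln_z]) simp
      show "continuous_on UNIV (\<lambda>w. k (- ln (z w)))"
        by (rule continuous_on_compose2[OF k ln_z]) simp
    qed
    have [measurable]: "g \<in> borel_measurable borel"
      using cont by (rule borel_measurable_continuous_onI)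
    \<comment> \<open>For \<open>v > n\<close> the argument of \<open>ln\<close> is frozen at
      \<open>exp (- real n)\<close>, where the cutoff is already 0, so both sides vanish.\<close>
    have eq: "g (exp (- v)) * exp (- v) = c n v * k v" for v
    proof (cases "v \<le> real n")
      case True
      then have "z (exp (- v)) = exp (- v)" by (simp add: z_def)
      then show ?thesis by (simp add: g_def)
    next
      case False
      then have "z (exp (- v)) = exp (- real n)" by (simp add: z_def)
      then show ?thesis using False by (simp add: g_def c_def)
    qed
    have "(\<integral>x. g (exp (- \<rho> x)) *\<^sub>R exp (- \<rho> x) *\<^sub>R f x \<partial>M) = 0"
      by (rule integral_exp_scaled_eq_0[OF _ pos int zero continuous_on_subset[OF cont]]) auto
    then show ?thesis by (simp add: eq)
  qed
  have "(\<lambda>n. \<integral>x. c n (\<rho> x) *\<^sub>R k (\<rho> x) *\<^sub>R f x \<partial>M) \<longlonglongrightarrow> (\<integral>x. k (\<rho> x) *\<^sub>R f x \<partial>M)"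
  proof (rule integral_dominated_convergence[where w = "\<lambda>x. norm (k (\<rho> x) *\<^sub>R f x)"])
    show "(\<lambda>x. k (\<rho> x) *\<^sub>R f x) \<in> borel_measurable M" using kint by measurable
    then show "(\<lambda>x. c n (\<rho> x) *\<^sub>R k (\<rho> x) *\<^sub>R f x) \<in> borel_measurable M" for n by measurable
    show "integrable M (\<lambda>x. norm (k (\<rho> x) *\<^sub>R f x))" using kint by (rule integrable_norm)
    show "AE x in M. norm (c n (\<rho> x) *\<^sub>R k (\<rho> x) *\<^sub>R f x) \<le> norm (k (\<rho> x) *\<^sub>R f x)" for n
    proof (rule AE_I2)
      fix x
      have "\<bar>c n (\<rho> x)\<bar> \<le> 1" by (auto simp: c_def)
      then show "norm (c n (\<rho> x) *\<^sub>R k (\<rho> x) *\<^sub>R f x) \<le> norm (k (\<rho> x) *\<^sub>R f x)"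
        unfolding norm_scaleR[of "c n (\<rho> x)"] by (rule mult_left_le_one_le[rotated 2]) auto
    qed
    show "AE x in M. (\<lambda>n. c n (\<rho> x) *\<^sub>R k (\<rho> x) *\<^sub>R f x) \<longlonglongrightarrow> k (\<rho> x) *\<^sub>R f x"
    proof (rule AE_I2, rule tendsto_eventually)
      fix x
      show "\<forall>\<^sub>F n in sequentially. c n (\<rho> x) *\<^sub>R k (\<rho> x) *\<^sub>R f x = k (\<rho> x) *\<^sub>R f x"
        using eventually_ge_at_top[of "nat \<lceil>\<rho> x + 1\<rceil>"]
      proof eventually_elim
        case (elim n)
        then have "c n (\<rho> x) = 1" by (simp add: c_def) linarith
        then show ?case by simp
      qed
    qed
  qed
  then show ?thesis unfolding cutoff by (simp add: LIMSEQ_const_iff)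
qed

subsection \<open>Polar coordinates\<close>

lemma nn_integral_sphere_measure:
  fixes h :: "'a::euclidean_space \<Rightarrow> ennreal"
  assumes h [measurable]: "h \<in> borel_measurable borel"
  shows "(\<integral>\<^sup>+\<omega>. h \<omega> \<partial>sphere_measure) =
    of_nat DIM('a) * (\<integral>\<^sup>+x. h (x /\<^sub>R norm x) * indicator (ball 0 1 - {0}) x \<partial>lborel)"
proof -
  have "h \<in> borel_measurable (restrict_space borel (sphere 0 1))"
    using h by (rule measurable_restrict_space1)
  then show ?thesis
    unfolding sphere_measure_def
    by (simp add: nn_integral_scale_measure nn_integral_distr[OF radial_projection_measurable]
        nn_integral_restrict_space)
qed

text \<open>The sigma-algebra of \<open>sphere_measure\<close> is the trace on the sphere; composing
  with this inclusion makes Borel functions on the whole space measurable for it.\<close>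

lemma measurable_sphere_measure: "(\<lambda>\<omega>. \<omega>) \<in> sphere_measure \<rightarrow>\<^sub>M borel"
proof -
  have "(\<lambda>\<omega>::'a. \<omega>) \<in> restrict_space borel (sphere 0 1) \<rightarrow>\<^sub>M borel"
    by (rule measurable_restrict_space1) simp
  moreover have "sets (sphere_measure :: 'a measure) = sets (restrict_space borel (sphere 0 1))"
    by (simp add: sphere_measure_def)
  ultimately show ?thesis by (subst measurable_cong_sets[OF _ refl])
qed

lemma space_sphere_measure [simp]: "space sphere_measure = sphere 0 1"
  by (simp add: sphere_measure_def space_scale_measure space_restrict_space)

text \<open>The total mass is at most \<open>DIM('a)\<close> times the volume of the unit ball.
  Finiteness is what permits Fubini on the product with the radial line, and constant majorants on
  the sphere.\<close>

interpretation sphere_measure: finite_measure "sphere_measure :: 'a::euclidean_space measure"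
proof
  have "emeasure (sphere_measure :: 'a measure) (sphere 0 1)
      \<le> of_nat DIM('a) * emeasure lborel (ball (0::'a) 1)"
    by (subst emeasure_sphere_measure) (auto intro!: mult_left_mono emeasure_mono)
  also have "\<dots> < \<infinity>"
    using emeasure_bounded_finite[of "ball (0::'a) 1"] by (simp add: ennreal_mult_less_top of_nat_less_top)
  finally show "emeasure (sphere_measure :: 'a measure) (space sphere_measure) \<noteq> \<infinity>" by simp
qed

lemma nn_integral_scaleR:
  fixes f :: "'a::euclidean_space \<Rightarrow> ennreal"
  assumes [measurable]: "f \<in> borel_measurable borel" and c: "c \<noteq> 0"
  shows "(\<integral>\<^sup>+x. f x \<partial>lborel) = ennreal (\<bar>c\<bar> ^ DIM('a)) * (\<integral>\<^sup>+x. f (c *\<^sub>R x) \<partial>lborel)"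
  by (subst lborel_affine[OF c, of 0])
     (simp add: nn_integral_density nn_integral_distr nn_integral_cmult)

text \<open>The antiderivative is \<open>- inverse (real n * l ^ n)\<close>, which tends to 0 at
  infinity. This is the innermost integral in the polar coordinate formula.\<close>

lemma nn_integral_inverse_power_tail:
  assumes "0 < a" and "0 < n"
  shows "(\<integral>\<^sup>+l. ennreal (inverse (l ^ Suc n)) * indicator {a<..} l \<partial>lborel)
    = ennreal (inverse (real n * a ^ n))"
proof -
  define f where "f l = (if a \<le> l then inverse (l ^ Suc n) else 0)" for l :: real
  have [measurable]: "f \<in> borel_measurable borel" unfolding f_def by measurable
  have "(\<integral>\<^sup>+l. ennreal (inverse (l ^ Suc n)) * indicator {a<..} l \<partial>lborel)
      = (\<integral>\<^sup>+l. ennreal (f l) * indicator {a..} l \<partial>lborel)"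
  \<comment> \<open>The fundamental theorem is applied on the closed half-line, which differs from
    the open one by the null set \<open>{a}\<close>.\<close>
  proof (rule nn_integral_cong_AE)
    show "AE l in lborel. ennreal (inverse (l ^ Suc n)) * indicator {a<..} l
        = ennreal (f l) * indicator {a..} l"
      using AE_lborel_singleton[of a] by eventually_elim (auto simp: f_def split: split_indicator)
  qed
  also have "\<dots> = ennreal (0 - (- inverse (real n * a ^ n)))"
  proof (rule nn_integral_FTC_atLeast)
    show "DERIV (\<lambda>l. - inverse (real n * l ^ n)) x :> f x" if "a \<le> x" for x
    proof -
      have "x > 0" using that assms by linarith
      moreover have "x ^ n = x * x ^ (n - 1)" using \<open>0 < n\<close> by (cases n) auto
      ultimately show ?thesis
        using that assms unfolding f_def
        by (auto intro!: derivative_eq_intros simp: field_simps power2_eq_square)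
    qed
    show "((\<lambda>l. - inverse (real n * l ^ n)) \<longlongrightarrow> 0) at_top"
      using \<open>0 < n\<close> by real_asymp
    show "0 \<le> f x" if "a \<le> x" for x using that assms by (simp add: f_def)
  qed measurable
  finally show ?thesis by simp
qed

text \<open>
  Since \<open>sphere_measure\<close> is a cone measure, the right-hand side is an integral over
  \<open>r > 0\<close> and \<open>x\<close> in the unit ball. Substituting \<open>r = l * norm x\<close> and then \<open>y = l *\<^sub>R x\<close> leaves,
  for each \<open>y\<close>, the elementary integral of \<open>l ^ (- N - 1)\<close> over \<open>l > norm y\<close>.
\<close>

lemma nn_integral_polar:
  fixes f :: "'a::euclidean_space \<Rightarrow> ennreal"
  assumes [measurable]: "f \<in> borel_measurable borel"
  shows "(\<integral>\<^sup>+x. f x \<partial>lborel) =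
    (\<integral>\<^sup>+r. \<integral>\<^sup>+\<omega>. ennreal (r ^ (DIM('a) - 1)) * indicator {0<..} r * f (r *\<^sub>R \<omega>) \<partial>sphere_measure \<partial>lborel)"
    (is "_ = ?rhs")
proof -
  define N where "N = DIM('a)"
  have N: "N = Suc (N - 1)" "N > 0" by (auto simp: N_def)
  define A where "A r = ennreal (r ^ (N - 1)) * indicator {0<..} r" for r :: real
  define B where "B = ball (0::'a) 1 - {0}"
  have [measurable]: "A \<in> borel_measurable borel" unfolding A_def by measurable
  have [measurable]: "B \<in> sets borel" unfolding B_def by auto
  have [measurable]: "- {0::'a} \<in> sets borel" by auto
  have [measurable]: "Measurable.pred (borel \<Otimes>\<^sub>M borel) (\<lambda>p::'a \<times> real. snd p \<in> {norm (fst p)<..})"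
    unfolding greaterThan_iff by measurable
  \<comment> \<open>One factor \<open>c\<close> is the Jacobian of \<open>r = c * l\<close>, the
    other \<open>N - 1\<close> come from the density \<open>r ^ (N - 1)\<close>.\<close>
  have A_scale: "ennreal c * A (c * l) = ennreal (c ^ N) * A l" if "c > 0" for c l
  proof (cases "l > 0")
    case True
    then show ?thesis
      using that N by (simp add: A_def power_mult_distrib ennreal_mult[symmetric] mult.assoc[symmetric]
          flip: power_Suc)
  next
    case False
    then have "\<not> c * l > 0" using that by (simp add: zero_less_mult_iff)
    then show ?thesis using False by (simp add: A_def)
  qed
  have "?rhs = (\<integral>\<^sup>+r. of_nat N * (\<integral>\<^sup>+x. A r * f (r *\<^sub>R x /\<^sub>R norm x) * indicator B x \<partial>lborel) \<partial>lborel)"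
    by (subst nn_integral_sphere_measure) (auto simp: A_def B_def N_def mult.commute)
  also have "\<dots> = of_nat N * (\<integral>\<^sup>+r. (\<integral>\<^sup>+x. A r * f (r *\<^sub>R x /\<^sub>R norm x) * indicator B x \<partial>lborel) \<partial>lborel)"
    by (rule nn_integral_cmult) measurable
  also have "(\<integral>\<^sup>+r. (\<integral>\<^sup>+x. A r * f (r *\<^sub>R x /\<^sub>R norm x) * indicator B x \<partial>lborel) \<partial>lborel)
      = (\<integral>\<^sup>+x. (\<integral>\<^sup>+r. A r * f (r *\<^sub>R x /\<^sub>R norm x) * indicator B x \<partial>lborel) \<partial>lborel)"
    by (rule lborel_pair.Fubini') measurable
  also have "\<dots> = (\<integral>\<^sup>+x. (\<integral>\<^sup>+l. ennreal (norm x ^ N) * A l * f (l *\<^sub>R x) * indicator B x \<partial>lborel) \<partial>lborel)"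
  proof (rule nn_integral_cong)
    fix x :: 'a
    show "(\<integral>\<^sup>+r. A r * f (r *\<^sub>R x /\<^sub>R norm x) * indicator B x \<partial>lborel)
        = (\<integral>\<^sup>+l. ennreal (norm x ^ N) * A l * f (l *\<^sub>R x) * indicator B x \<partial>lborel)"
    proof (cases "x \<in> B")
      case True
      then have x: "norm x > 0" by (auto simp: B_def)
      have "(\<integral>\<^sup>+r. A r * f (r *\<^sub>R x /\<^sub>R norm x) \<partial>lborel)
          = ennreal (norm x) * (\<integral>\<^sup>+l. A (norm x * l) * f (l *\<^sub>R x) \<partial>lborel)"
        using x by (subst nn_integral_real_affine[where c = "norm x" and t = 0]) (auto simp: field_simps)
      also have "\<dots> = (\<integral>\<^sup>+l. ennreal (norm x ^ N) * A l * f (l *\<^sub>R x) \<partial>lborel)"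
        by (subst nn_integral_cmult[symmetric]) (auto simp: mult.assoc[symmetric] A_scale[OF x])
      finally show ?thesis using True by simp
    qed simp
  qed
  also have "\<dots> = (\<integral>\<^sup>+l. (\<integral>\<^sup>+x. ennreal (norm x ^ N) * A l * f (l *\<^sub>R x) * indicator B x \<partial>lborel) \<partial>lborel)"
    by (rule lborel_pair.Fubini'[symmetric]) measurable
  also have "\<dots> = (\<integral>\<^sup>+l. (\<integral>\<^sup>+y. ennreal (norm y ^ N) * f y *
      (ennreal (inverse (l ^ Suc N)) * indicator {norm y<..} l) * indicator (- {0}) y \<partial>lborel) \<partial>lborel)"
  proof (rule nn_integral_cong)
    fix l :: real
    show "(\<integral>\<^sup>+x. ennreal (norm x ^ N) * A l * f (l *\<^sub>R x) * indicator B x \<partial>lborel) =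
      (\<integral>\<^sup>+y. ennreal (norm y ^ N) * f y *
      (ennreal (inverse (l ^ Suc N)) * indicator {norm y<..} l) * indicator (- {0}) y \<partial>lborel)"
    proof (cases "l > 0")
      case l: True
      have "(\<integral>\<^sup>+x. ennreal (norm x ^ N) * A l * f (l *\<^sub>R x) * indicator B x \<partial>lborel)
          = ennreal (inverse l ^ N) * (\<integral>\<^sup>+y. ennreal (norm (inverse l *\<^sub>R y) ^ N) * A l
             * f (l *\<^sub>R inverse l *\<^sub>R y) * indicator B (inverse l *\<^sub>R y) \<partial>lborel)"
        using l by (subst nn_integral_scaleR[where c = "inverse l"]) (auto simp: N_def)
      also have "\<dots> = (\<integral>\<^sup>+y. ennreal (inverse l ^ N) * (ennreal (norm (inverse l *\<^sub>R y) ^ N) * A l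
             * f (l *\<^sub>R inverse l *\<^sub>R y) * indicator B (inverse l *\<^sub>R y)) \<partial>lborel)"
        by (rule nn_integral_cmult[symmetric]) measurable
      also have "\<dots> = (\<integral>\<^sup>+y. ennreal (norm y ^ N) * f y *
          (ennreal (inverse (l ^ Suc N)) * indicator {norm y<..} l) * indicator (- {0}) y \<partial>lborel)"
      proof (rule nn_integral_cong)
        fix y :: 'a
        have ind: "indicator B (inverse l *\<^sub>R y) = (indicator {norm y<..} l * indicator (- {0}) y :: ennreal)"
          using l by (auto simp: B_def field_simps split: split_indicator)
        \<comment> \<open>Powers of \<open>l\<close>: \<open>- N\<close> from the Jacobian,
          \<open>- N\<close> from the scaled norm and \<open>N - 1\<close> from \<open>A\<close> add
          up to \<open>- N - 1\<close>.\<close>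
        have "inverse l ^ N * (norm (inverse l *\<^sub>R y) ^ N * l ^ (N - 1)) = norm y ^ N * inverse (l ^ Suc N)"
        proof -
          have "l * l ^ (N - Suc 0) = l ^ N" using N(2) by (simp flip: power_Suc)
          then show ?thesis using l by (simp add: power_mult_distrib field_simps)
        qed
        then have key: "ennreal (inverse l ^ N) * (ennreal (norm (inverse l *\<^sub>R y) ^ N) * ennreal (l ^ (N - 1)))
            = ennreal (norm y ^ N) * ennreal (inverse (l ^ Suc N))"
          using l by (simp add: ennreal_mult[symmetric])
        have "A l = ennreal (l ^ (N - 1))" "l *\<^sub>R inverse l *\<^sub>R y = y" using l by (auto simp: A_def)
        then have "ennreal (inverse l ^ N) * (ennreal (norm (inverse l *\<^sub>R y) ^ N) * A l
             * f (l *\<^sub>R inverse l *\<^sub>R y) * indicator B (inverse l *\<^sub>R y))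
          = (ennreal (inverse l ^ N) * (ennreal (norm (inverse l *\<^sub>R y) ^ N) * ennreal (l ^ (N - 1))))
             * (f y * (indicator {norm y<..} l * indicator (- {0}) y))"
          by (simp only: ind mult.assoc)
        also have "\<dots> = ennreal (norm y ^ N) * f y *
          (ennreal (inverse (l ^ Suc N)) * indicator {norm y<..} l) * indicator (- {0}) y"
          unfolding key by (simp only: mult_ac)
        finally show "ennreal (inverse l ^ N) * (ennreal (norm (inverse l *\<^sub>R y) ^ N) * A l
             * f (l *\<^sub>R inverse l *\<^sub>R y) * indicator B (inverse l *\<^sub>R y))
          = ennreal (norm y ^ N) * f y *
          (ennreal (inverse (l ^ Suc N)) * indicator {norm y<..} l) * indicator (- {0}) y" .
      qed
      finally show ?thesis .
    next
      case False
      \<comment> \<open>For \<open>l \<le> 0\<close> both integrands vanish: the left one through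
        \<open>A\<close>, the right one because norms are nonnegative.\<close>
      then have "\<not> norm y < l" for y :: 'a using norm_ge_zero[of y] by linarith
      then show ?thesis using False by (simp add: A_def)
    qed
  qed
  also have "\<dots> = (\<integral>\<^sup>+y. (\<integral>\<^sup>+l. ennreal (norm y ^ N) * f y *
      (ennreal (inverse (l ^ Suc N)) * indicator {norm y<..} l) * indicator (- {0}) y \<partial>lborel) \<partial>lborel)"
    by (rule lborel_pair.Fubini') measurable
  also have "of_nat N * \<dots> = (\<integral>\<^sup>+y. of_nat N * (\<integral>\<^sup>+l. ennreal (norm y ^ N) * f y *
      (ennreal (inverse (l ^ Suc N)) * indicator {norm y<..} l) * indicator (- {0}) y \<partial>lborel) \<partial>lborel)"
    by (rule nn_integral_cmult[symmetric]) measurable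
  also have "\<dots> = (\<integral>\<^sup>+y. f y \<partial>lborel)"
  proof (rule nn_integral_cong_AE)
    show "AE y in lborel. of_nat N * (\<integral>\<^sup>+l. ennreal (norm y ^ N) * f y *
      (ennreal (inverse (l ^ Suc N)) * indicator {norm y<..} l) * indicator (- {0}) y \<partial>lborel) = f y"
      \<comment> \<open>The origin is a null set; away from it the tail integral exactly cancels
        \<open>N * norm y ^ N\<close>.\<close>
      using AE_lborel_singleton[of 0]
    proof eventually_elim
      case (elim y)
      then have y: "norm y > 0" by simp
      have "(\<integral>\<^sup>+l. ennreal (norm y ^ N) * f y *
          (ennreal (inverse (l ^ Suc N)) * indicator {norm y<..} l) * indicator (- {0}) y \<partial>lborel)
        = (\<integral>\<^sup>+l. ennreal (norm y ^ N) * f y *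
          (ennreal (inverse (l ^ Suc N)) * indicator {norm y<..} l) \<partial>lborel)"
        using y by simp
      also have "\<dots> = ennreal (norm y ^ N) * f y * ennreal (inverse (real N * norm y ^ N))"
        unfolding nn_integral_inverse_power_tail[OF y N(2), symmetric]
        by (rule nn_integral_cmult) measurable
      finally have "of_nat N * (\<integral>\<^sup>+l. ennreal (norm y ^ N) * f y *
          (ennreal (inverse (l ^ Suc N)) * indicator {norm y<..} l) * indicator (- {0}) y \<partial>lborel)
        = f y * (ennreal N * (ennreal (norm y ^ N) * ennreal (inverse (real N * norm y ^ N))))"
        by (simp add: mult_ac ennreal_of_nat_eq_real_of_nat)
      also have "ennreal N * (ennreal (norm y ^ N) * ennreal (inverse (real N * norm y ^ N))) = 1"
      proof -
        have "real N * (norm y ^ N * inverse (real N * norm y ^ N)) = 1"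
          using y N(2) by (simp add: field_simps)
        then show ?thesis by (simp only: ennreal_mult'[symmetric] ennreal_1 zero_le_power norm_ge_zero of_nat_0_le_iff)
      qed
      finally show ?case by simp
    qed
  qed
  finally show ?thesis by simp
qed

text \<open>The nonnegative formula, applied to indicators, exhibits \<open>lborel\<close> as the
  image of a weighted product measure under
  \<open>(r, \<omega>) \<mapsto> r *\<^sub>R \<omega>\<close>; Fubini on the product then handles
  vector-valued integrands. The integrability claim is needed later to pass from a zero integral to
  an integrand that is zero almost everywhere.\<close>

lemma integral_polar:
  fixes f :: "'a::euclidean_space \<Rightarrow> 'b::{banach, second_countable_topology}"
  assumes int: "integrable lborel f"
  shows "(\<integral>x. f x \<partial>lborel) =
    (\<integral>r. (r ^ (DIM('a) - 1) * indicator {0<..} r) *\<^sub>R (\<integral>\<omega>. f (r *\<^sub>R \<omega>) \<partial>sphere_measure) \<partial>lborel)"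
    and "integrable lborel
      (\<lambda>r. (r ^ (DIM('a) - 1) * indicator {0<..} r) *\<^sub>R (\<integral>\<omega>. f (r *\<^sub>R \<omega>) \<partial>sphere_measure))"
proof -
  have [measurable]: "f \<in> borel_measurable borel" using int by simp
  let ?S = "sphere_measure :: 'a measure"
  note measurable_sphere_measure [measurable]
  interpret P: pair_sigma_finite "lborel :: real measure" ?S ..
  define w where "w r = r ^ (DIM('a) - 1) * indicator {0<..} r" for r :: real
  have [measurable]: "w \<in> borel_measurable borel" unfolding w_def by measurable
  have w: "w r \<ge> 0" for r by (auto simp: w_def split: split_indicator)
  have snd [measurable]: "(\<lambda>p. snd p) \<in> (lborel :: real measure) \<Otimes>\<^sub>M ?S \<rightarrow>\<^sub>M borel"
    by (rule measurable_compose[OF measurable_snd measurable_sphere_measure])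
  have T [measurable]: "(\<lambda>p. fst p *\<^sub>R snd p) \<in> (lborel :: real measure) \<Otimes>\<^sub>M ?S \<rightarrow>\<^sub>M borel"
    by measurable
  have polar: "lborel = distr (density (lborel \<Otimes>\<^sub>M ?S) (\<lambda>p. ennreal (w (fst p)))) borel (\<lambda>p. fst p *\<^sub>R snd p)"
    (is "_ = distr ?D _ _")
  proof (rule measure_eqI)
    fix X :: "'a set" assume "X \<in> sets lborel"
    then have [measurable]: "X \<in> sets borel" by simp
    have "emeasure (distr ?D borel (\<lambda>p. fst p *\<^sub>R snd p)) X
        = (\<integral>\<^sup>+p. indicator X (fst p *\<^sub>R snd p) \<partial>?D)"
      by (subst nn_integral_indicator[symmetric], simp, subst nn_integral_distr) auto
    also have "\<dots> = (\<integral>\<^sup>+p. ennreal (w (fst p)) * indicator X (fst p *\<^sub>R snd p) \<partial>(lborel \<Otimes>\<^sub>M ?S))"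
      by (rule nn_integral_density) measurable
    also have "\<dots> = (\<integral>\<^sup>+r. \<integral>\<^sup>+\<omega>. ennreal (w r) * indicator X (r *\<^sub>R \<omega>) \<partial>?S \<partial>lborel)"
      by (subst sphere_measure.nn_integral_fst[symmetric]) auto
    also have "\<dots> = (\<integral>\<^sup>+r. \<integral>\<^sup>+\<omega>. ennreal (r ^ (DIM('a) - 1)) * indicator {0<..} r
        * indicator X (r *\<^sub>R \<omega>) \<partial>?S \<partial>lborel)"
      by (intro nn_integral_cong) (auto simp: w_def split: split_indicator)
    also have "\<dots> = emeasure lborel X"
      by (subst nn_integral_polar[symmetric]) auto
    finally show "emeasure lborel X = emeasure (distr ?D borel (\<lambda>p. fst p *\<^sub>R snd p)) X" by simp
  qed simp
  have T': "(\<lambda>p. fst p *\<^sub>R snd p) \<in> ?D \<rightarrow>\<^sub>M borel" by measurable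
  have "integrable ?D (\<lambda>p. f (fst p *\<^sub>R snd p))"
    using int by (subst (asm) polar) (simp add: integrable_distr_eq[OF T'])
  then have I: "integrable (lborel \<Otimes>\<^sub>M ?S) (\<lambda>p. w (fst p) *\<^sub>R f (fst p *\<^sub>R snd p))"
    by (subst (asm) integrable_density) (auto simp: w)
  have "(\<integral>x. f x \<partial>lborel) = (\<integral>p. f (fst p *\<^sub>R snd p) \<partial>?D)"
    by (subst polar, subst integral_distr[OF T']) auto
  also have "\<dots> = (\<integral>p. w (fst p) *\<^sub>R f (fst p *\<^sub>R snd p) \<partial>(lborel \<Otimes>\<^sub>M ?S))"
    by (subst integral_density) (auto simp: w)
  also have "\<dots> = (\<integral>r. \<integral>\<omega>. w r *\<^sub>R f (r *\<^sub>R \<omega>) \<partial>?S \<partial>lborel)"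
    using P.integral_fst'[OF I] by simp
  finally show "(\<integral>x. f x \<partial>lborel) =
    (\<integral>r. (r ^ (DIM('a) - 1) * indicator {0<..} r) *\<^sub>R (\<integral>\<omega>. f (r *\<^sub>R \<omega>) \<partial>sphere_measure) \<partial>lborel)"
    by (simp add: w_def)
  show "integrable lborel
      (\<lambda>r. (r ^ (DIM('a) - 1) * indicator {0<..} r) *\<^sub>R (\<integral>\<omega>. f (r *\<^sub>R \<omega>) \<partial>sphere_measure))"
    using P.integrable_fst'[OF I] by (simp add: w_def)
qed

subsection \<open>Gaussians and the Fourier transform\<close>

text \<open>\<open>lborel\<close> is the image of a product of one-dimensional Lebesgue measures
  under the coordinate map, so integrals of products over coordinates factor.\<close>

lemma
  fixes f :: "'a::euclidean_space \<Rightarrow> real \<Rightarrow> 'b::{real_normed_field, banach, second_countable_topology}"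
  assumes int: "\<And>b. b \<in> Basis \<Longrightarrow> integrable lborel (f b)"
  shows integrable_lborel_prod: "integrable lborel (\<lambda>x. \<Prod>b\<in>Basis. f b (x \<bullet> b))"
    and integral_lborel_prod:
      "(\<integral>x. (\<Prod>b\<in>Basis. f b (x \<bullet> b)) \<partial>lborel) = (\<Prod>b\<in>Basis. \<integral>v. f b v \<partial>lborel)"
proof -
  interpret product_sigma_finite "\<lambda>_::'a. lborel :: real measure" ..
  have [measurable]: "f b \<in> borel_measurable borel" if "b \<in> Basis" for b
    using int[OF that] by simp
  have fm: "(\<lambda>x. \<Prod>b\<in>Basis. f b (x \<bullet> b)) \<in> borel_measurable borel" by measurable
  have T: "(\<lambda>g. \<Sum>b\<in>Basis. g b *\<^sub>R b) \<in> (\<Pi>\<^sub>M b\<in>(Basis::'a set). lborel) \<rightarrow>\<^sub>M borel" by measurable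
  have eq: "(\<Prod>b\<in>Basis. f b ((\<Sum>i\<in>Basis. g i *\<^sub>R i) \<bullet> b)) = (\<Prod>b\<in>Basis. f b (g b))" for g
    by (intro prod.cong) auto
  show "integrable lborel (\<lambda>x. \<Prod>b\<in>Basis. f b (x \<bullet> b))"
    by (subst lborel_eq, subst integrable_distr_eq[OF T fm], subst eq)
      (intro product_integrable_prod int finite_Basis)
  show "(\<integral>x. (\<Prod>b\<in>Basis. f b (x \<bullet> b)) \<partial>lborel) = (\<Prod>b\<in>Basis. \<integral>v. f b v \<partial>lborel)"
    by (subst lborel_eq, subst integral_distr[OF T fm], subst eq)
      (intro product_integral_prod int finite_Basis)
qed

text \<open>The majorant is a multiple of the product of
  \<open>inverse (1 + (x \<bullet> b)\<^sup>2)\<close> over the coordinates, which is integrable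
  factor by factor. It dominates because the product of the
  \<open>1 + (x \<bullet> b)\<^sup>2\<close> is at most
  \<open>(1 + (norm x)\<^sup>2) ^ DIM('a)\<close>, a polynomial that the exponential beats.\<close>

lemma integrable_exp_neg_powr:
  assumes a: "0 < a" and c: "0 < c"
  shows "integrable lborel (\<lambda>x::'a::euclidean_space. exp (- (c * norm x powr a)))"
proof -
  let ?N = "DIM('a)"
  have "((\<lambda>r. (1 + r\<^sup>2) ^ ?N * exp (- (c * r powr a))) \<longlongrightarrow> 0) at_top"
    using a c by real_asymp
  then have "\<forall>\<^sub>F r in at_top. (1 + r\<^sup>2) ^ ?N * exp (- (c * r powr a)) < 1"
    by (rule order_tendstoD) simp
  then obtain R where R: "\<And>r. r \<ge> R \<Longrightarrow> (1 + r\<^sup>2) ^ ?N * exp (- (c * r powr a)) < 1"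
    by (auto simp: eventually_at_top_linorder)
  \<comment> \<open>Sum of two bounds: 1 beyond \<open>R\<close>, and
    \<open>(1 + R\<^sup>2) ^ ?N\<close> on [0,R), where the exponential is at most 1.\<close>
  define C where "C = 1 + (1 + R\<^sup>2) ^ ?N"
  have C: "(1 + r\<^sup>2) ^ ?N * exp (- (c * r powr a)) \<le> C" if "r \<ge> 0" for r
  proof (cases "r \<ge> R")
    case True
    have "0 \<le> (1 + R\<^sup>2) ^ ?N" by simp
    then show ?thesis using R[OF True] unfolding C_def by linarith
  next
    case False
    have "(1 + r\<^sup>2) ^ ?N * exp (- (c * r powr a)) \<le> (1 + R\<^sup>2) ^ ?N * 1"
      using that False c by (intro mult_mono power_mono) (auto intro: power_mono)
    then show ?thesis by (simp add: C_def)
  qed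
  have one: "integrable lborel (\<lambda>v::real. inverse (1 + v\<^sup>2))"
    using integrable_inverse_1_plus_square by (simp add: set_integrable_def)
  show ?thesis
  proof (rule Bochner_Integration.integrable_bound)
    show "integrable lborel (\<lambda>x::'a. C * (\<Prod>b\<in>Basis. inverse (1 + (x \<bullet> b)\<^sup>2)))"
      using one by (intro integrable_mult_right integrable_lborel_prod)
    show "AE x::'a in lborel. norm (exp (- (c * norm x powr a)))
        \<le> norm (C * (\<Prod>b\<in>Basis. inverse (1 + (x \<bullet> b)\<^sup>2)))"
    proof (rule AE_I2)
      fix x :: 'a
      let ?P = "\<Prod>b\<in>Basis. 1 + (x \<bullet> b)\<^sup>2"
      have P: "?P > 0" by (intro prod_pos) (simp add: add_pos_nonneg)
      have "?P \<le> (\<Prod>b\<in>(Basis::'a set). 1 + (norm x)\<^sup>2)"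
      proof (rule prod_mono)
        fix b :: 'a assume "b \<in> Basis"
        then have "\<bar>x \<bullet> b\<bar> \<le> norm x" by (rule Basis_le_norm)
        then have "\<bar>x \<bullet> b\<bar>\<^sup>2 \<le> (norm x)\<^sup>2" by (intro power_mono) auto
        then show "0 \<le> 1 + (x \<bullet> b)\<^sup>2 \<and> 1 + (x \<bullet> b)\<^sup>2 \<le> 1 + (norm x)\<^sup>2" by simp
      qed
      then have "?P * exp (- (c * norm x powr a)) \<le> (1 + (norm x)\<^sup>2) ^ ?N * exp (- (c * norm x powr a))"
        by (intro mult_right_mono) auto
      also have "\<dots> \<le> C" by (rule C) simp
      finally have "exp (- (c * norm x powr a)) \<le> C * inverse ?P"
        using P by (simp add: field_simps)
      also have "\<dots> \<le> norm (C * (\<Prod>b\<in>Basis. inverse (1 + (x \<bullet> b)\<^sup>2)))"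
        by (simp add: prod_inversef[symmetric] o_def)
      finally show "norm (exp (- (c * norm x powr a)))
        \<le> norm (C * (\<Prod>b\<in>Basis. inverse (1 + (x \<bullet> b)\<^sup>2)))" by simp
    qed
  qed measurable
qed

text \<open>The integral is a rescaled characteristic function of the standard normal
  distribution.\<close>

lemma fourier_gaussian_real:
  fixes c w :: real
  assumes c: "0 < c"
  shows "integrable lborel (\<lambda>v. complex_of_real (exp (- (c * v\<^sup>2))) * iexp (w * v))"
    and "(\<integral>v. complex_of_real (exp (- (c * v\<^sup>2))) * iexp (w * v) \<partial>lborel)
      = complex_of_real (sqrt (pi / c) * exp (- (w\<^sup>2 / (4 * c))))"
proof -
  \<comment> \<open>Chosen so that \<open>(q * v)\<^sup>2 / 2 = c * v\<^sup>2\<close>; evaluating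
    \<open>char\<close> at \<open>w / q\<close> then leaves the frequency \<open>w\<close> after the
    substitution.\<close>
  define q where "q = sqrt (2 * c)"
  have q: "q > 0" "q\<^sup>2 = 2 * c" using c by (auto simp: q_def)
  have "integrable lborel (\<lambda>v::real. exp (- (c * norm v powr 2)))"
    using c by (intro integrable_exp_neg_powr) auto
  then have gi: "integrable lborel (\<lambda>v. exp (- (c * v\<^sup>2)))" by simp
  show "integrable lborel (\<lambda>v. complex_of_real (exp (- (c * v\<^sup>2))) * iexp (w * v))"
    by (rule Bochner_Integration.integrable_bound[OF gi]) (auto simp: norm_mult)
  have "char std_normal_distribution (w / q) = complex_of_real (exp (- (w / q)\<^sup>2 / 2))"
    by (simp add: char_std_normal_distribution)
  also have "char std_normal_distribution (w / q)
      = (\<integral>v. std_normal_density v *\<^sub>R iexp (w / q * v) \<partial>lborel)"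
    unfolding char_def by (subst integral_density) auto
  also have "\<dots> = q *\<^sub>R (\<integral>v. std_normal_density (q * v) *\<^sub>R iexp (w * v) \<partial>lborel)"
    using q by (subst lborel_integral_real_affine[where c = q and t = 0]) auto
  also have "(\<lambda>v. std_normal_density (q * v) *\<^sub>R iexp (w * v))
      = (\<lambda>v. complex_of_real (1 / sqrt (2 * pi)) * (complex_of_real (exp (- (c * v\<^sup>2))) * iexp (w * v)))"
    using q(2) by (auto simp: std_normal_density_def scaleR_conv_of_real power_mult_distrib)
  finally have "complex_of_real (q / sqrt (2 * pi)) *
      (\<integral>v. complex_of_real (exp (- (c * v\<^sup>2))) * iexp (w * v) \<partial>lborel)
      = complex_of_real (exp (- (w / q)\<^sup>2 / 2))"
    by (simp add: scaleR_conv_of_real)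
  moreover have "sqrt (2 * pi) / q = sqrt (pi / c)"
    using c by (simp add: q_def real_sqrt_divide[symmetric])
  then have "complex_of_real (sqrt (pi / c)) * complex_of_real (q / sqrt (2 * pi)) = 1"
    using q c by (simp flip: of_real_mult add: field_simps)
  moreover have "- (w / q)\<^sup>2 / 2 = - (w\<^sup>2 / (4 * c))"
    using q(2) by (simp add: power_divide)
  ultimately show "(\<integral>v. complex_of_real (exp (- (c * v\<^sup>2))) * iexp (w * v) \<partial>lborel)
      = complex_of_real (sqrt (pi / c) * exp (- (w\<^sup>2 / (4 * c))))"
    by (metis (no_types, lifting) mult.assoc mult_1 of_real_mult)
qed

text \<open>Gaussian and character both factor over the coordinates, which leaves the
  one-dimensional integral at frequency \<open>2 * pi * (x \<bullet> b)\<close>.\<close>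

lemma inv_fourier_gaussian:
  fixes x :: "'a::euclidean_space"
  assumes c: "0 < c"
  shows "inv_fourier (\<lambda>\<xi>. complex_of_real (exp (- (c * (norm \<xi>)\<^sup>2)))) x
    = complex_of_real (sqrt (pi / c) ^ DIM('a) * exp (- (pi\<^sup>2 / c * (norm x)\<^sup>2)))"
proof -
  have norm_sq: "(norm y)\<^sup>2 = (\<Sum>b\<in>Basis. (y \<bullet> b)\<^sup>2)" for y :: 'a
    unfolding power2_norm_eq_inner by (subst euclidean_inner) (simp add: power2_eq_square)
  define f where "f b v = complex_of_real (exp (- (c * v\<^sup>2))) * iexp (2 * pi * (x \<bullet> b) * v)" for b v
  have "complex_of_real (exp (- (c * (norm \<xi>)\<^sup>2))) * exp (2 * pi * \<i> * complex_of_real (x \<bullet> \<xi>))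
      = (\<Prod>b\<in>Basis. f b (\<xi> \<bullet> b))" for \<xi>
  proof -
    have "x \<bullet> \<xi> = (\<Sum>b\<in>Basis. (x \<bullet> b) * (\<xi> \<bullet> b))" by (rule euclidean_inner)
    then have "exp (2 * pi * \<i> * complex_of_real (x \<bullet> \<xi>)) = (\<Prod>b\<in>Basis. iexp (2 * pi * (x \<bullet> b) * (\<xi> \<bullet> b)))"
      by (subst exp_sum[symmetric]) (auto simp: sum_distrib_left mult_ac)
    moreover have "exp (- (c * (norm \<xi>)\<^sup>2)) = (\<Prod>b\<in>Basis. exp (- (c * (\<xi> \<bullet> b)\<^sup>2)))"
      by (subst exp_sum[symmetric]) (auto simp: norm_sq sum_distrib_left sum_negf)
    ultimately show ?thesis by (simp add: f_def prod.distrib)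
  qed
  then have "inv_fourier (\<lambda>\<xi>. complex_of_real (exp (- (c * (norm \<xi>)\<^sup>2)))) x
      = (\<integral>\<xi>. (\<Prod>b\<in>Basis. f b (\<xi> \<bullet> b)) \<partial>lborel)"
    unfolding inv_fourier_def by simp
  also have "\<dots> = (\<Prod>b\<in>Basis. \<integral>v. f b v \<partial>lborel)"
    unfolding f_def by (rule integral_lborel_prod) (rule fourier_gaussian_real(1)[OF c])
  also have "\<dots> = (\<Prod>b\<in>Basis. complex_of_real (sqrt (pi / c) * exp (- ((2 * pi * (x \<bullet> b))\<^sup>2 / (4 * c)))))"
    unfolding f_def fourier_gaussian_real(2)[OF c] ..
  also have "\<dots> = complex_of_real (sqrt (pi / c) ^ DIM('a) * (\<Prod>b\<in>Basis. exp (- (pi\<^sup>2 / c * (x \<bullet> b)\<^sup>2))))"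
    by (simp add: prod.distrib power_mult_distrib)
  also have "(\<Prod>b\<in>Basis. exp (- (pi\<^sup>2 / c * (x \<bullet> b)\<^sup>2))) = exp (- (pi\<^sup>2 / c * (norm x)\<^sup>2))"
    by (subst exp_sum[symmetric]) (auto simp: norm_sq sum_distrib_left sum_negf)
  finally show ?thesis .
qed

section \<open>Measurability, boundedness and the multiplication formula for
  \<open>inv_fourier\<close>\<close>

lemma borel_measurable_inv_fourier [measurable]:
  assumes [measurable]: "f \<in> borel_measurable borel"
  shows "inv_fourier f \<in> borel_measurable borel"
proof -
  have "(\<lambda>x. \<integral>\<xi>. f \<xi> * exp (2 * pi * \<i> * complex_of_real (x \<bullet> \<xi>)) \<partial>lborel) \<in> borel_measurable borel"
    by (rule lborel.borel_measurable_lebesgue_integral) measurable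
  then show ?thesis by (simp add: inv_fourier_def[abs_def])
qed

lemma norm_inv_fourier_le: "norm (inv_fourier f x) \<le> (\<integral>\<xi>. norm (f \<xi>) \<partial>lborel)"
  unfolding inv_fourier_def by (rule order_trans[OF integral_norm_bound]) (simp add: norm_mult norm_exp_eq_Re)

text \<open>Fubini applies because the exponential has modulus 1 and \<open>f\<close>,
  \<open>g\<close> are integrable. The signs fit the application: the heat kernel is evaluated at
  \<open>0 - y\<close>, and \<open>inv_fourier g (- \<xi>)\<close> is the Fourier transform of
  \<open>g\<close>.\<close>

lemma integral_inv_fourier_mult:
  fixes f g :: "'a::euclidean_space \<Rightarrow> complex"
  assumes f: "integrable lborel f" and g: "integrable lborel g"
  shows "(\<integral>y. inv_fourier f (- y) * g y \<partial>lborel) = (\<integral>\<xi>. f \<xi> * inv_fourier g (- \<xi>) \<partial>lborel)"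
proof -
  define e where "e y \<xi> = exp (2 * pi * \<i> * complex_of_real (- (y \<bullet> \<xi>)))" for y \<xi> :: 'a
  have e: "norm (e y \<xi>) = 1" for y \<xi> by (simp add: e_def norm_exp_eq_Re)
  have [measurable]: "f \<in> borel_measurable borel" "g \<in> borel_measurable borel" using f g by auto
  have [measurable]: "(\<lambda>p. e (fst p) (snd p)) \<in> borel_measurable (borel \<Otimes>\<^sub>M borel)"
    unfolding e_def by measurable
  have [measurable]: "e y \<in> borel_measurable borel" for y
    unfolding e_def by measurable
  have int: "integrable (lborel \<Otimes>\<^sub>M lborel) (\<lambda>p. f (snd p) * e (fst p) (snd p) * g (fst p))"
  proof (rule lborel_pair.Fubini_integrable)
    show "(\<lambda>p. f (snd p) * e (fst p) (snd p) * g (fst p)) \<in> borel_measurable (lborel \<Otimes>\<^sub>M lborel)"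
      by measurable
    show "integrable lborel (\<lambda>y. \<integral>\<xi>. norm (f (snd (y, \<xi>)) * e (fst (y, \<xi>)) (snd (y, \<xi>)) * g (fst (y, \<xi>))) \<partial>lborel)"
      using f g by (simp add: norm_mult e)
    show "AE y in lborel. integrable lborel (\<lambda>\<xi>. f (snd (y, \<xi>)) * e (fst (y, \<xi>)) (snd (y, \<xi>)) * g (fst (y, \<xi>)))"
    proof (rule AE_I2)
      fix y :: 'a
      have "integrable lborel (\<lambda>\<xi>. f \<xi> * e y \<xi>)"
        by (rule Bochner_Integration.integrable_bound[OF f]) (auto simp: norm_mult e)
      then show "integrable lborel (\<lambda>\<xi>. f (snd (y, \<xi>)) * e (fst (y, \<xi>)) (snd (y, \<xi>)) * g (fst (y, \<xi>)))"
        by simp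
    qed
  qed
  have "(\<integral>y. inv_fourier f (- y) * g y \<partial>lborel) = (\<integral>y. \<integral>\<xi>. f \<xi> * e y \<xi> * g y \<partial>lborel \<partial>lborel)"
    by (simp add: inv_fourier_def e_def)
  also have "\<dots> = (\<integral>\<xi>. \<integral>y. f \<xi> * e y \<xi> * g y \<partial>lborel \<partial>lborel)"
    using int by (intro lborel_pair.Fubini_integral[symmetric]) (simp add: split_def)
  also have "\<dots> = (\<integral>\<xi>. f \<xi> * inv_fourier g (- \<xi>) \<partial>lborel)"
    by (simp add: inv_fourier_def e_def inner_commute mult_ac)
  finally show ?thesis .
qed

subsection \<open>Radial test functions\<close>

text \<open>The function \<open>exp (- (t * norm x powr b))\<close> is a continuous function of
  \<open>norm x powr a\<close>, so \<open>laplace_uniqueness\<close> applies with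
  \<open>\<rho> x = norm x powr a\<close>. A bounded \<open>f\<close> suffices since the
  exponentials are integrable.\<close>

lemma laplace_change_exponent:
  fixes f :: "'a::euclidean_space \<Rightarrow> 'b::{banach, second_countable_topology}"
  assumes ab: "0 < a" "0 < b"
    and [measurable]: "f \<in> borel_measurable borel" and bound: "\<And>x. norm (f x) \<le> C"
    and zero: "\<And>t. t > 0 \<Longrightarrow> (\<integral>x. exp (- (t * norm x powr a)) *\<^sub>R f x \<partial>lborel) = 0"
    and t: "0 < t"
  shows "(\<integral>x. exp (- (t * norm x powr b)) *\<^sub>R f x \<partial>lborel) = 0"
proof -
  \<comment> \<open>The absolute value makes \<open>k\<close> continuous on the whole line.\<close>
  define k where "k v = exp (- (t * \<bar>v\<bar> powr (b / a)))" for v :: real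
  have k: "k (norm x powr a) = exp (- (t * norm x powr b))" for x :: 'a
    using ab by (simp add: k_def powr_powr)
  have int: "integrable lborel (\<lambda>x. exp (- (c * norm x powr p)) *\<^sub>R f x)" if "0 < c" "0 < p" for c p
  proof (rule Bochner_Integration.integrable_bound)
    show "integrable lborel (\<lambda>x::'a. exp (- (c * norm x powr p)) * C)"
      using that by (intro integrable_mult_left integrable_exp_neg_powr) auto
    have "norm (f x) \<le> \<bar>C\<bar>" for x using bound[of x] by linarith
    then show "AE x in lborel. norm (exp (- (c * norm x powr p)) *\<^sub>R f x)
        \<le> norm (exp (- (c * norm x powr p)) * C)"
      by (simp add: abs_mult)
  qed measurable
  have "(\<integral>x. k (norm x powr a) *\<^sub>R f x \<partial>lborel) = 0"
  proof (rule laplace_uniqueness[where \<rho> = "\<lambda>x. norm x powr a" and k = k])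
    show "integrable lborel (\<lambda>x. exp (- (norm x powr a)) *\<^sub>R f x)"
      using int[of 1 a] ab by simp
    show "(\<integral>x. exp (- (real n * norm x powr a)) *\<^sub>R f x \<partial>lborel) = 0" if "n > 0" for n
      using zero[of "real n"] that by simp
    show "continuous_on UNIV k"
      unfolding k_def using ab by (intro continuous_intros continuous_on_powr') auto
    show "integrable lborel (\<lambda>x. k (norm x powr a) *\<^sub>R f x)"
      unfolding k using t ab by (intro int)
  qed auto
  then show ?thesis by (simp add: k)
qed

section \<open>Spherical means of continuous functions with compact support\<close>

lemma
  fixes f :: "'a::euclidean_space \<Rightarrow> 'b::euclidean_space"
  assumes f: "continuous_on UNIV f" and supp: "compact (supp f)"
  shows bounded_range_compact_supp: "bounded (range f)"
    and integrable_compact_supp: "integrable lborel f"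
proof -
  have out: "f x = 0" if "x \<notin> supp f" for x
    using that closure_subset[of "{x. f x \<noteq> 0}"] by (auto simp: supp_def)
  have cont: "continuous_on (supp f) f" using f by (rule continuous_on_subset) simp
  have "bounded (insert 0 (f ` supp f))"
    using compact_imp_bounded[OF compact_continuous_image[OF cont supp]] by simp
  then show "bounded (range f)" by (rule bounded_subset) (use out in auto)
  have "(\<lambda>x. indicator (supp f) x *\<^sub>R f x) = f"
    by (auto simp: out split: split_indicator)
  then show "integrable lborel f" using borel_integrable_compact[OF supp cont] by simp
qed

text \<open>Dominated convergence, with a bound of \<open>f\<close> as majorant, integrable on the
  finite measure space of the sphere.\<close>

lemma continuous_on_spherical_mean:
  fixes f :: "'a::euclidean_space \<Rightarrow> 'b::euclidean_space"
  assumes f: "continuous_on UNIV f" and bound: "bounded (range f)"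
  shows "continuous_on UNIV (\<lambda>r. \<integral>\<omega>. f (r *\<^sub>R \<omega>) \<partial>sphere_measure)"
proof -
  note measurable_sphere_measure [measurable]
  obtain K where K: "\<And>x. norm (f x) \<le> K" using bound by (auto simp: bounded_iff)
  have [measurable]: "f \<in> borel_measurable borel" using f by (rule borel_measurable_continuous_onI)
  show ?thesis
    unfolding continuous_on_sequentially o_def
  proof (intro ballI allI impI, elim conjE)
    fix x :: "nat \<Rightarrow> real" and a assume x: "x \<longlonglongrightarrow> a"
    show "(\<lambda>n. \<integral>\<omega>. f (x n *\<^sub>R \<omega>) \<partial>sphere_measure) \<longlonglongrightarrow> (\<integral>\<omega>. f (a *\<^sub>R \<omega>) \<partial>sphere_measure)"
    proof (rule integral_dominated_convergence[where w = "\<lambda>_. K"])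
      show "AE \<omega> in sphere_measure. (\<lambda>n. f (x n *\<^sub>R \<omega>)) \<longlonglongrightarrow> f (a *\<^sub>R \<omega>)"
        by (intro AE_I2 continuous_on_tendsto_compose[OF f] tendsto_intros x) auto
    qed (use K in auto)
  qed
qed

text \<open>The set of \<open>r > 0\<close> with \<open>g r \<noteq> 0\<close> is open and null,
  hence empty; the endpoint 0 follows by continuity from the closure of the half-line.\<close>

lemma continuous_AE_eq_0:
  fixes g :: "real \<Rightarrow> 'b::real_normed_vector"
  assumes g: "continuous_on UNIV g" and ae: "AE r in lborel. 0 < r \<longrightarrow> g r = 0" and r: "0 \<le> r"
  shows "g r = 0"
proof -
  let ?S = "{r \<in> {0<..}. g r \<in> - {0}}"
  have "open ?S"
    using continuous_open_preimage[OF continuous_on_subset[OF g] open_greaterThan, of 0 "- {0}"]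
    by (auto simp: vimage_def Int_def)
  moreover have "negligible ?S"
  proof -
    have S: "?S \<in> sets lborel" using \<open>open ?S\<close> by simp
    have "AE r in lborel. r \<notin> ?S" using ae by eventually_elim auto
    then have "?S \<in> null_sets lborel" using S by (simp add: AE_iff_null_sets)
    then show ?thesis by (auto simp: negligible_iff_null_sets intro: null_sets_completionI)
  qed
  ultimately have "?S = {}" using open_not_negligible by blast
  then have z: "g x = 0" if "x \<in> {0<..}" for x using that by auto
  have "r \<in> closure {0<..}" using r by simp
  then show ?thesis
    using continuous_constant_on_closure[OF continuous_on_subset[OF g] z] by blast
qed

text \<open>In polar coordinates a radial weight leaves the sphere integral, so \<open>f\<close>
  enters only through its spherical mean; this gives one direction. For the other, Laplace
  uniqueness in \<open>(norm y)\<^sup>2\<close> extends orthogonality from Gaussians to other radial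
  weights.\<close>

lemma gaussian_integrals_eq_0_iff:
  fixes f :: "'a::euclidean_space \<Rightarrow> real"
  assumes f: "continuous_on UNIV f" and supp: "compact (supp f)"
  shows "(\<forall>c>0. (\<integral>y. exp (- (c * (norm y)\<^sup>2)) * f y \<partial>lborel) = 0) \<longleftrightarrow>
    (\<forall>r\<ge>0. (\<integral>\<omega>. f (r *\<^sub>R \<omega>) \<partial>sphere_measure) = 0)" (is "?gauss \<longleftrightarrow> ?mean")
proof -
  define M where "M r = (\<integral>\<omega>. f (r *\<^sub>R \<omega>) \<partial>sphere_measure)" for r
  define w where "w r = r ^ (DIM('a) - 1) * indicator {0<..} r" for r :: real
  note bdd = bounded_range_compact_supp[OF f supp] and int = integrable_compact_supp[OF f supp]
  have [measurable]: "f \<in> borel_measurable borel" using f by (rule borel_measurable_continuous_onI)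
  have M: "continuous_on UNIV M"
    unfolding M_def by (rule continuous_on_spherical_mean[OF f bdd])
  have prod_int: "integrable lborel (\<lambda>y. k (norm y) * f y)" if k: "continuous_on UNIV k" for k
  proof -
    have "continuous_on UNIV (\<lambda>y::'a. k (norm y))"
      by (rule continuous_on_compose2[OF k]) (auto intro: continuous_intros)
    then have "continuous_on UNIV (\<lambda>y. k (norm y) * f y)" using f by (rule continuous_on_mult)
    moreover have "supp (\<lambda>y. k (norm y) * f y) \<subseteq> supp f"
      unfolding supp_def by (rule closure_mono) auto
    then have "compact (supp (\<lambda>y. k (norm y) * f y))"
      using supp by (metis closed_Int_compact closed_closure inf.absorb1 supp_def)
    ultimately show ?thesis by (rule integrable_compact_supp)
  qed
  have polar: "(\<integral>y. k (norm y) * f y \<partial>lborel) = (\<integral>r. w r * (k r * M r) \<partial>lborel)"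
    "integrable lborel (\<lambda>r. w r * (k r * M r))" if k: "continuous_on UNIV k" for k
  proof -
    have eq: "w r *\<^sub>R (\<integral>\<omega>. k (norm (r *\<^sub>R \<omega>)) * f (r *\<^sub>R \<omega>) \<partial>sphere_measure) = w r * (k r * M r)" for r
    proof (cases "r > 0")
      case True
      have "(\<integral>\<omega>. k (norm (r *\<^sub>R \<omega>)) * f (r *\<^sub>R \<omega>) \<partial>sphere_measure)
          = (\<integral>\<omega>. k r * f (r *\<^sub>R \<omega>) \<partial>sphere_measure)"
        using True by (intro Bochner_Integration.integral_cong) auto
      then show ?thesis by (simp add: M_def)
    qed (simp add: w_def)
    show "(\<integral>y. k (norm y) * f y \<partial>lborel) = (\<integral>r. w r * (k r * M r) \<partial>lborel)"
      "integrable lborel (\<lambda>r. w r * (k r * M r))"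
      using integral_polar[OF prod_int[OF k]] unfolding w_def[symmetric] eq by simp_all
  qed
  show ?thesis
  proof
    assume ?mean
    then have "(\<lambda>r. w r * (k r * M r)) = (\<lambda>_. 0)" for k
      by (auto simp: w_def M_def split: split_indicator)
    then have z: "(\<integral>r. w r * (k r * M r) \<partial>lborel) = 0" for k by simp
    show ?gauss
      using polar(1)[of "\<lambda>r. exp (- (c * r\<^sup>2))" for c] by (auto simp: z continuous_intros)
  next
    assume gauss: ?gauss
    \<comment> \<open>Testing \<open>f\<close> against its own spherical mean gives the integral of \<open>M\<^sup>2\<close>.\<close>
    define k where "k v = M (sqrt \<bar>v\<bar>)" for v
    have k: "k ((norm y)\<^sup>2) = M (norm y)" for y :: 'a by (simp add: k_def)
    have "(\<integral>y. k ((norm y)\<^sup>2) *\<^sub>R f y \<partial>lborel) = 0"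
    proof (rule laplace_uniqueness[where \<rho> = "\<lambda>y. (norm y)\<^sup>2" and k = k])
      show "integrable lborel (\<lambda>y. exp (- (norm y)\<^sup>2) *\<^sub>R f y)"
        using prod_int[of "\<lambda>r. exp (- r\<^sup>2)"] by (simp add: continuous_intros)
      show "(\<integral>y. exp (- (real n * (norm y)\<^sup>2)) *\<^sub>R f y \<partial>lborel) = 0" if "n > 0" for n
        using gauss that by simp
      show "continuous_on UNIV k"
        unfolding k_def by (rule continuous_on_compose2[OF M]) (auto intro!: continuous_intros)
      show "integrable lborel (\<lambda>y. k ((norm y)\<^sup>2) *\<^sub>R f y)"
        using prod_int[OF M] by (simp add: k)
    qed auto
    then have "(\<integral>r. w r * (M r * M r) \<partial>lborel) = 0"
      using polar(1)[OF M] by (simp add: k)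
    \<comment> \<open>The integrand is nonnegative and has integral 0; as \<open>w\<close> is
      positive for \<open>r > 0\<close>, the mean vanishes almost everywhere there and then
      everywhere by continuity.\<close>
    then have "AE r in lborel. w r * (M r * M r) = 0"
      by (subst (asm) integral_nonneg_eq_0_iff_AE[OF polar(2)[OF M]])
        (auto simp: w_def split: split_indicator)
    then have "AE r in lborel. 0 < r \<longrightarrow> M r = 0"
      by eventually_elim (auto simp: w_def)
    then show ?mean
      using continuous_AE_eq_0[OF M] by (simp add: M_def)
  qed
qed

section \<open>From the heat solution at the origin to the spherical means of the initial
  datum\<close>

theorem theorem3p4:
  fixes s L :: real
    and u0 :: "real ^ 'n \<Rightarrow> real"
    and u :: "real ^ 'n \<Rightarrow> real \<Rightarrow> complex"
  assumes "0 < s" and "s < 1"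
    and "test_function u0"
    and "0 < L" and "supp u0 \<subseteq> ball 0 L"
    and "u = frac_heat_solution s u0"
  shows "(\<forall>t>0. u 0 t = 0) \<longleftrightarrow>
         (\<forall>r\<ge>0. (\<integral>\<omega>. u0 (r *\<^sub>R \<omega>) \<partial>sphere_measure) = 0)"
proof -
  have u0: "continuous_on UNIV u0" "compact (supp u0)"
    using assms(3) Ck.simps(1) unfolding test_function_def by blast+
  define g where "g y = complex_of_real (u0 y)" for y
  \<comment> \<open>The Fourier transform of \<open>u0\<close>; it is bounded because
    \<open>u0\<close> is integrable.\<close>
  define F where "F \<xi> = inv_fourier g (- \<xi>)" for \<xi>
  have g: "integrable lborel g"
    using integrable_compact_supp[OF u0] unfolding g_def by simp
  then have [measurable]: "F \<in> borel_measurable borel" unfolding F_def by measurable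
  have F: "norm (F \<xi>) \<le> (\<integral>y. norm (g y) \<partial>lborel)" for \<xi>
    unfolding F_def by (rule norm_inv_fourier_le)
  \<comment> \<open>The exponent stays general: \<open>a = 2 * s\<close> gives the heat solution and
    \<open>a = 2\<close> the Gaussians.\<close>
  have parseval: "(\<integral>y. inv_fourier (\<lambda>\<xi>. complex_of_real (exp (- (c * norm \<xi> powr a)))) (- y) * g y \<partial>lborel)
      = (\<integral>\<xi>. exp (- (c * norm \<xi> powr a)) *\<^sub>R F \<xi> \<partial>lborel)" if "0 < c" "0 < a" for c a
  proof -
    have "integrable lborel (\<lambda>\<xi>::real ^ 'n. complex_of_real (exp (- (c * norm \<xi> powr a))))"
      using that by (intro integrable_of_real integrable_exp_neg_powr)
    from integral_inv_fourier_mult[OF this g] show ?thesis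
      by (simp add: F_def scaleR_conv_of_real)
  qed
  \<comment> \<open>The constant of the symbol is absorbed into time; \<open>t * c0\<close> still
    runs through all positive reals.\<close>
  define c0 where "c0 = (2 * pi) powr (2 * s)"
  have c0: "c0 > 0" by (simp add: c0_def)
  have u: "u 0 t = (\<integral>\<xi>. exp (- (t * c0 * norm \<xi> powr (2 * s))) *\<^sub>R F \<xi> \<partial>lborel)" if "t > 0" for t
  proof -
    have "- t * (2 * pi * norm \<xi>) powr (2 * s) = - (t * c0 * norm \<xi> powr (2 * s))" for \<xi> :: "real ^ 'n"
      by (simp add: c0_def powr_mult)
    then show ?thesis
      using parseval[of "t * c0" "2 * s"] that c0 assms(1)
      by (simp add: assms(6) frac_heat_solution_def frac_heat_kernel_def g_def mult.assoc)
  qed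
  \<comment> \<open>The two integrals differ by the nonzero factor
    \<open>sqrt (pi / c) ^ CARD('n)\<close>.\<close>
  have gauss: "(\<integral>\<xi>. exp (- (c * norm \<xi> powr 2)) *\<^sub>R F \<xi> \<partial>lborel) = 0 \<longleftrightarrow>
      (\<integral>y. exp (- (pi\<^sup>2 / c * (norm y)\<^sup>2)) * u0 y \<partial>lborel) = 0" if "c > 0" for c
  proof -
    have "(\<integral>\<xi>. exp (- (c * norm \<xi> powr 2)) *\<^sub>R F \<xi> \<partial>lborel)
        = (\<integral>y. complex_of_real (sqrt (pi / c) ^ CARD('n) * (exp (- (pi\<^sup>2 / c * (norm y)\<^sup>2)) * u0 y)) \<partial>lborel)"
      using that by (subst parseval[symmetric]) (auto simp: inv_fourier_gaussian g_def mult.assoc)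
    also have "\<dots> = complex_of_real (sqrt (pi / c) ^ CARD('n) * (\<integral>y. exp (- (pi\<^sup>2 / c * (norm y)\<^sup>2)) * u0 y \<partial>lborel))"
      by (simp only: integral_complex_of_real integral_mult_right_zero)
    finally show ?thesis using that by simp
  qed
  have "(\<forall>t>0. u 0 t = 0) \<longleftrightarrow> (\<forall>c>0. (\<integral>\<xi>. exp (- (c * norm \<xi> powr (2 * s))) *\<^sub>R F \<xi> \<partial>lborel) = 0)"
  proof safe
    fix c :: real assume "\<forall>t>0. u 0 t = 0" and "0 < c"
    then show "(\<integral>\<xi>. exp (- (c * norm \<xi> powr (2 * s))) *\<^sub>R F \<xi> \<partial>lborel) = 0"
      using u[of "c / c0"] c0 by simp
  qed (use u c0 in simp)
  also have "\<dots> \<longleftrightarrow> (\<forall>c>0. (\<integral>\<xi>. exp (- (c * norm \<xi> powr 2)) *\<^sub>R F \<xi> \<partial>lborel) = 0)"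
    using laplace_change_exponent[of "2 * s" 2 F, OF _ _ _ F]
      laplace_change_exponent[of 2 "2 * s" F, OF _ _ _ F] assms(1) by auto
  also have "\<dots> \<longleftrightarrow> (\<forall>c>0. (\<integral>y. exp (- (c * (norm y)\<^sup>2)) * u0 y \<partial>lborel) = 0)"
  \<comment> \<open>The parameter change \<open>c \<mapsto> pi\<^sup>2 / c\<close> is an involution
    of the positive reals, so both families run over all Gaussians.\<close>
  proof safe
    fix c :: real assume *: "\<forall>c>0. (\<integral>\<xi>. exp (- (c * norm \<xi> powr 2)) *\<^sub>R F \<xi> \<partial>lborel) = 0" and "0 < c"
    then have "pi\<^sup>2 / c > 0" by simp
    moreover have "pi\<^sup>2 / (pi\<^sup>2 / c) = c" by simp
    ultimately show "(\<integral>y. exp (- (c * (norm y)\<^sup>2)) * u0 y \<partial>lborel) = 0"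
      using gauss[of "pi\<^sup>2 / c"] * by metis
  next
    fix c :: real assume *: "\<forall>c>0. (\<integral>y. exp (- (c * (norm y)\<^sup>2)) * u0 y \<partial>lborel) = 0" and "0 < c"
    then have "pi\<^sup>2 / c > 0" by simp
    then show "(\<integral>\<xi>. exp (- (c * norm \<xi> powr 2)) *\<^sub>R F \<xi> \<partial>lborel) = 0"
      using gauss[OF \<open>0 < c\<close>] * by blast
  qed
  also have "\<dots> \<longleftrightarrow> (\<forall>r\<ge>0. (\<integral>\<omega>. u0 (r *\<^sub>R \<omega>) \<partial>sphere_measure) = 0)"
    by (rule gaussian_integrals_eq_0_iff[OF u0])
  finally show ?thesis .
qed

end
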